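(* Let $C \subsetneq \mathbb{R}^d$ be a closed convex cone with $0 \in C$, let $0 < \alpha \leq 1$, and let $VaR_\alpha(X) = Q^-_{-X,C}(1-\alpha)$ for random variables $X \colon \Omega \to \mathbb{R}^d$. (a) For every random variable $X \colon \Omega \to \mathbb{R}^d$, \[ VaR_\alpha(X) = \Big\{z \in \mathbb{R}^d \;\Big|\; \sup_{w \in C^+\setminus\{0\}} P(X+z \in -\operatorname{int} H^+(w)) \leq \alpha\Big\} = \bigcap_{w \in C^+\setminus\{0\}} \{z \in \mathbb{R}^d \mid P(X+z \in -\operatorname{int} H^+(w)) \leq \alpha\}. \] (b) The function $X \mapsto VaR_\alpha(X)$ maps into $\mathcal{G}(\mathbb{R}^d, C)$, is positively homogeneous, and is $\mathbb{R}^d$-translative, i.e. $VaR_\alpha(X + y\mathbf{1}) = VaR_\alpha(X) - y$ for all $y \in \mathbb{R}^d$. (c) $X \mapsto VaR_\alpha(X)$ is monotone nonincreasing with respect to $\leq_C$, i.e. $X \leq_C Y$ (almost surely) implies $VaR_\alpha(X) \subseteq VaR_\alpha(Y)$.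
   Context: $(\Omega,\mathcal{F},P)$ is a probability space; random variables $\Omega \to \mathbb{R}^d$ are Borel measurable maps. A cone is a set $C \subseteq \mathbb{R}^d$ with $sz \in C$ for all $s>0$, $z \in C$. $z \leq_C z'$ means $z'-z \in C$; for random variables it is understood almost surely. The dual cone is $C^+ = \{w \in \mathbb{R}^d \mid w^Tz \geq 0 \text{ for all } z \in C\}$; for $w \neq 0$, $H^+(w) = \{z \in \mathbb{R}^d\mid w^Tz \geq 0\}$. $F_{X,C}(z) = \inf_{w \in C^+\setminus\{0\}} P(w^TX \leq w^Tz)$ and $Q^-_{X,C}(p) = \{z \in \mathbb{R}^d \mid F_{X,C}(z) \geq p\}$ for $p \in [0,1]$; $Q^-_{-X,C}$ is this object for the random variable $-X$. $\mathcal{G}(\mathbb{R}^d,C) = \{B \subseteq \mathbb{R}^d \mid B = \operatorname{cl}\operatorname{co}(B+C)\}$, where $B + C$ is the Minkowski sum ($\emptyset + C = \emptyset$), $\operatorname{co}$ the convex hull and $\operatorname{cl}$ the closure. $\mathbf{1}$ is the constant function $\Omega \to \mathbb{R}$ with value $1$, so $X + y\mathbf{1}$ is $\omega \mapsto X(\omega)+y$. Positively homogeneous means $VaR_\alpha(sX) = s\,VaR_\alpha(X)$ for all $s > 0$, with $sB = \{sb \mid b \in B\}$, $s\emptyset=\emptyset$. *)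

theory Defs
  imports "HOL-Probability.Probability" "HOL-Library.Set_Algebras"
begin

text \<open>The library's \<^const>\<open>cone\<close> also demands closure under multiplication by zero;
  here only strictly positive scalars are required.\<close>

definition pos_cone :: "(real ^ 'n) set \<Rightarrow> bool" where
  "pos_cone C \<longleftrightarrow> (\<forall>s>0. \<forall>z\<in>C. s *\<^sub>R z \<in> C)"

definition cone_le :: "(real ^ 'n) set \<Rightarrow> real ^ 'n \<Rightarrow> real ^ 'n \<Rightarrow> bool" where
  "cone_le C z z' \<longleftrightarrow> z' - z \<in> C"

definition dual_cone :: "(real ^ 'n) set \<Rightarrow> (real ^ 'n) set" where
  "dual_cone C = {w. \<forall>z\<in>C. 0 \<le> w \<bullet> z}"

definition pos_halfspace :: "real ^ 'n \<Rightarrow> (real ^ 'n) set" where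
  "pos_halfspace w = {z. 0 \<le> w \<bullet> z}"

text \<open>The infimum is taken in the reals. It is the usual one whenever the dual cone contains a
  nonzero vector, in particular for every closed convex cone that contains the origin and is not
  the whole space; otherwise the index set is empty and the value is arbitrary.\<close>

definition cone_cdf ::
  "'a measure \<Rightarrow> (real ^ 'n) set \<Rightarrow> ('a \<Rightarrow> real ^ 'n) \<Rightarrow> real ^ 'n \<Rightarrow> real" where
  "cone_cdf M C X z =
     (INF w\<in>dual_cone C - {0}. measure M {\<omega> \<in> space M. w \<bullet> X \<omega> \<le> w \<bullet> z})"

definition lower_cone_quantile ::
  "'a measure \<Rightarrow> (real ^ 'n) set \<Rightarrow> ('a \<Rightarrow> real ^ 'n) \<Rightarrow> real \<Rightarrow> (real ^ 'n) set" where
  "lower_cone_quantile M C X p = {z. p \<le> cone_cdf M C X z}"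

definition VaR ::
  "'a measure \<Rightarrow> (real ^ 'n) set \<Rightarrow> real \<Rightarrow> ('a \<Rightarrow> real ^ 'n) \<Rightarrow> (real ^ 'n) set" where
  "VaR M C \<alpha> X = lower_cone_quantile M C (\<lambda>\<omega>. - X \<omega>) (1 - \<alpha>)"

text \<open>The sum of two sets is the Minkowski sum of \<^theory>\<open>HOL-Library.Set_Algebras\<close>.\<close>

definition closed_convex_upper_sets :: "(real ^ 'n) set \<Rightarrow> (real ^ 'n) set set" where
  "closed_convex_upper_sets C = {B. B = closure (convex hull (B + C))}"

end

theory Submission
  imports Defs
begin

text \<open>For a fixed direction \<open>w\<close>, membership of \<open>z\<close> in the value at risk is a condition on
  the number \<open>t = w \<bullet> z\<close> alone, namely \<open>P (w \<bullet> X + t < 0) \<le> \<alpha>\<close>. By monotonicity and continuity of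
  measure, the solutions \<open>t\<close> form a closed upper set of reals, so the value at risk is an
  intersection of closed half-spaces with normals in the dual cone (or of trivial sets). Separation
  of a point from \<open>C\<close> shows that the intersection is over a nonempty family, so that the infimum
  in the definition is a genuine one.\<close>

text \<open>A functional that is bounded below on a set closed under positive scaling must be
  nonnegative there, so the normal of a hyperplane strictly separating a point from \<open>C\<close>
  already lies in the dual cone.\<close>

lemma dual_cone_nontrivial:
  fixes C :: "(real ^ 'n) set"
  assumes "closed C" "convex C" "pos_cone C" "0 \<in> C" "C \<noteq> UNIV"
  shows "dual_cone C - {0} \<noteq> {}"
proof -
  obtain z where "z \<notin> C" using assms(5) by blast
  then obtain a b where az: "a \<bullet> z < b" and aC: "\<And>x. x \<in> C \<Longrightarrow> b < a \<bullet> x"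
    using separating_hyperplane_closed_point[OF assms(2,1)] by blast
  have b: "b < 0" using aC[OF assms(4)] by simp
  have "0 \<le> a \<bullet> x" if x: "x \<in> C" for x
  proof (rule ccontr)
    assume "\<not> 0 \<le> a \<bullet> x"
    hence neg: "a \<bullet> x < 0" by simp
    \<comment> \<open>This factor scales \<open>x\<close> to a point of \<open>C\<close> on which
      \<open>a\<close> takes exactly the value \<open>b\<close>, against the strict bound
      \<open>aC\<close>.\<close>
    hence "0 < b / (a \<bullet> x)" using b by (simp add: divide_neg_neg)
    hence "(b / (a \<bullet> x)) *\<^sub>R x \<in> C" using assms(3) x unfolding pos_cone_def by blast
    from aC[OF this] neg show False by simp
  qed
  moreover have "a \<noteq> 0" using az b by auto
  ultimately show ?thesis unfolding dual_cone_def by blast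
qed

text \<open>Since \<open>w\<close> is nonzero, the interior of the half-space is the open one; for
  \<open>w = 0\<close> it would be the whole space and the equivalence would fail.\<close>

lemma add_mem_uminus_interior_pos_halfspace:
  fixes w x z :: "real ^ 'n"
  assumes "w \<noteq> 0"
  shows "x + z \<in> uminus ` interior (pos_halfspace w) \<longleftrightarrow> w \<bullet> x + w \<bullet> z < 0"
proof -
  have "interior (pos_halfspace w) = {v. w \<bullet> v > 0}"
    using interior_halfspace_ge[OF assms, of 0] unfolding pos_halfspace_def by simp
  moreover have "x + z \<in> uminus ` S \<longleftrightarrow> - (x + z) \<in> S" for S
    by (metis (no_types, lifting) image_iff minus_minus)
  ultimately show ?thesis by (auto simp: inner_simps)
qed

context prob_space
begin

text \<open>Complementary events turn the lower bound \<open>1 - \<alpha>\<close> into the upper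
  bound \<open>\<alpha>\<close>, and an infimum of a nonempty family bounded below is at least
  \<open>1 - \<alpha>\<close> iff every member is. All later properties are read off from this
  form.\<close>

lemma mem_VaR_iff:
  fixes X :: "'a \<Rightarrow> real ^ 'n"
  assumes [measurable]: "X \<in> borel_measurable M" and ne: "dual_cone C - {0} \<noteq> {}"
  shows "z \<in> VaR M C \<alpha> X \<longleftrightarrow>
    (\<forall>w\<in>dual_cone C - {0}. prob {\<omega> \<in> space M. w \<bullet> X \<omega> + w \<bullet> z < 0} \<le> \<alpha>)"
proof -
  have "prob {\<omega> \<in> space M. w \<bullet> - X \<omega> \<le> w \<bullet> z} = 1 - prob {\<omega> \<in> space M. w \<bullet> X \<omega> + w \<bullet> z < 0}"
    for w
  proof -
    have "{\<omega> \<in> space M. w \<bullet> - X \<omega> \<le> w \<bullet> z} = space M - {\<omega> \<in> space M. w \<bullet> X \<omega> + w \<bullet> z < 0}"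
      by auto
    thus ?thesis by (simp add: prob_compl)
  qed
  moreover have "bdd_below ((\<lambda>w. prob {\<omega> \<in> space M. w \<bullet> - X \<omega> \<le> w \<bullet> z}) ` (dual_cone C - {0}))"
    by (rule bdd_belowI2[of _ 0]) simp
  ultimately show ?thesis
    unfolding VaR_def lower_cone_quantile_def cone_cdf_def
    by (simp add: le_cINF_iff[OF ne])
qed

lemma prob_add_less_0_antimono:
  fixes Y :: "'a \<Rightarrow> real"
  assumes [measurable]: "Y \<in> borel_measurable M" and "s \<le> t"
  shows "prob {\<omega> \<in> space M. Y \<omega> + t < 0} \<le> prob {\<omega> \<in> space M. Y \<omega> + s < 0}"
  using assms(2) by (intro finite_measure_mono) auto

text \<open>The probability is antitone and right-continuous in \<open>t\<close>. If it exceeds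
  \<open>\<alpha>\<close> at \<open>t\<close>, it still does slightly to the right of
  \<open>t\<close> by continuity, and everywhere to the left by monotonicity.\<close>

lemma closed_prob_add_less_0_le:
  fixes Y :: "'a \<Rightarrow> real"
  assumes [measurable]: "Y \<in> borel_measurable M"
  shows "closed {t. prob {\<omega> \<in> space M. Y \<omega> + t < 0} \<le> \<alpha>}" (is "closed ?T")
proof -
  have "\<exists>e>0. ball t e \<subseteq> - ?T" if t: "t \<in> - ?T" for t
  proof -
    \<comment> \<open>Because the inequality is strict, these events increase to the event for
      \<open>t\<close> itself.\<close>
    define A where "A n = {\<omega> \<in> space M. Y \<omega> + (t + inverse (real (Suc n))) < 0}" for n
    have "incseq A"
    proof (rule incseq_SucI, unfold A_def, safe)
      fix n \<omega>
      have "inverse (real (Suc (Suc n))) \<le> inverse (real (Suc n))" by (simp add: field_simps)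
      thus "Y \<omega> + (t + inverse (real (Suc n))) < 0 \<Longrightarrow> Y \<omega> + (t + inverse (real (Suc (Suc n)))) < 0"
        by linarith
    qed
    moreover have "range A \<subseteq> sets M" unfolding A_def by auto
    ultimately have "(\<lambda>n. prob (A n)) \<longlonglongrightarrow> prob (\<Union>n. A n)"
      by (intro finite_Lim_measure_incseq)
    moreover have "(\<Union>n. A n) = {\<omega> \<in> space M. Y \<omega> + t < 0}"
    proof (intro equalityI subsetI)
      fix \<omega> assume "\<omega> \<in> {\<omega> \<in> space M. Y \<omega> + t < 0}"
      moreover from this obtain n where "inverse (real (Suc n)) < - (Y \<omega> + t)"
        using reals_Archimedean[of "- (Y \<omega> + t)"] by auto
      ultimately show "\<omega> \<in> (\<Union>n. A n)" unfolding A_def by (auto intro!: exI[of _ n])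
    next
      fix \<omega> assume "\<omega> \<in> (\<Union>n. A n)"
      then obtain n where "\<omega> \<in> space M" "Y \<omega> + (t + inverse (real (Suc n))) < 0"
        unfolding A_def by auto
      moreover have "0 < inverse (real (Suc n))" by simp
      ultimately have "\<omega> \<in> space M" "Y \<omega> + t < 0" by linarith+
      thus "\<omega> \<in> {\<omega> \<in> space M. Y \<omega> + t < 0}" by simp
    qed
    ultimately have "\<forall>\<^sub>F n in sequentially. \<alpha> < prob (A n)"
      using t by (intro order_tendstoD(1)[where y = "prob (\<Union>n. A n)"]) auto
    then obtain n where n: "\<alpha> < prob (A n)" by (auto simp: eventually_sequentially)
    \<comment> \<open>Only the right end of the ball matters: the bound at
      \<open>t + inverse (real (Suc n))\<close> passes to all smaller \<open>s\<close>.\<close>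
    have "ball t (inverse (real (Suc n))) \<subseteq> - ?T"
    proof
      fix s assume "s \<in> ball t (inverse (real (Suc n)))"
      hence "s \<le> t + inverse (real (Suc n))" by (simp add: dist_real_def)
      from prob_add_less_0_antimono[OF assms this] n show "s \<in> - ?T" unfolding A_def by simp
    qed
    thus ?thesis by (intro exI[of _ "inverse (real (Suc n))"]) simp
  qed
  thus ?thesis unfolding closed_def open_contains_ball by blast
qed

lemma convex_prob_add_less_0_le:
  fixes Y :: "'a \<Rightarrow> real"
  assumes [measurable]: "Y \<in> borel_measurable M"
  shows "convex {t. prob {\<omega> \<in> space M. Y \<omega> + t < 0} \<le> \<alpha>}"
  unfolding is_interval_convex_1[symmetric] is_interval_1
  using prob_add_less_0_antimono[OF assms] by (auto intro: order_trans)

text \<open>A closed convex set \<open>B\<close> with \<open>B + C = B\<close> is a fixed point of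
  the closed convex hull of \<open>B + C\<close>; this covers the empty set too.\<close>

lemma VaR_closed_convex_upper:
  fixes X :: "'a \<Rightarrow> real ^ 'n"
  assumes X[measurable]: "X \<in> borel_measurable M" and ne: "dual_cone C - {0} \<noteq> {}" and "0 \<in> C"
  shows "VaR M C \<alpha> X \<in> closed_convex_upper_sets C"
proof -
  let ?T = "\<lambda>w. {t. prob {\<omega> \<in> space M. w \<bullet> X \<omega> + t < 0} \<le> \<alpha>}"
  \<comment> \<open>Closedness and convexity of each set \<open>?T w\<close> of reals carry over to
    its preimage under a continuous linear functional, and then to the intersection.\<close>
  have V: "VaR M C \<alpha> X = (\<Inter>w\<in>dual_cone C - {0}. (\<lambda>z. w \<bullet> z) -` ?T w)"
    using mem_VaR_iff[OF X ne] by auto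
  have "closed (VaR M C \<alpha> X)" unfolding V
    by (intro closed_INT ballI continuous_closed_vimage closed_prob_add_less_0_le) auto
  moreover have "convex (VaR M C \<alpha> X)" unfolding V
    by (intro convex_INT convex_linear_vimage convex_prob_add_less_0_le)
       (auto intro!: bounded_linear.linear bounded_linear_inner_right)
  moreover have "VaR M C \<alpha> X + C = VaR M C \<alpha> X"
  proof (intro equalityI subsetI)
    fix z assume "z \<in> VaR M C \<alpha> X + C"
    then obtain b c where z: "z = b + c" and b: "b \<in> VaR M C \<alpha> X" and c: "c \<in> C"
      by (auto elim: set_plus_elim)
    have "prob {\<omega> \<in> space M. w \<bullet> X \<omega> + w \<bullet> z < 0} \<le> \<alpha>" if w: "w \<in> dual_cone C - {0}" for w
    proof -
      \<comment> \<open>Adding an element of \<open>C\<close> cannot decrease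
        \<open>w \<bullet> z\<close> for \<open>w\<close> in the dual cone, so the probability can
        only drop.\<close>
      have "w \<bullet> b \<le> w \<bullet> z" using w c unfolding z dual_cone_def by (simp add: inner_add_right)
      from prob_add_less_0_antimono[OF _ this, of "\<lambda>\<omega>. w \<bullet> X \<omega>"]
      have "prob {\<omega> \<in> space M. w \<bullet> X \<omega> + w \<bullet> z < 0} \<le> prob {\<omega> \<in> space M. w \<bullet> X \<omega> + w \<bullet> b < 0}"
        by simp
      also have "\<dots> \<le> \<alpha>" using b w mem_VaR_iff[OF X ne] by blast
      finally show ?thesis .
    qed
    thus "z \<in> VaR M C \<alpha> X" using mem_VaR_iff[OF X ne] by blast
  next
    fix z assume "z \<in> VaR M C \<alpha> X"
    thus "z \<in> VaR M C \<alpha> X + C" using set_plus_intro[OF _ assms(3)] by fastforce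
  qed
  ultimately show ?thesis
    unfolding closed_convex_upper_sets_def by (simp add: hull_same closure_closed)
qed

text \<open>A positive factor does not change the sign of
  \<open>w \<bullet> X \<omega> + w \<bullet> b\<close>, so the events for scaled and unscaled data
  coincide for every \<open>w\<close>.\<close>

lemma VaR_scaleR:
  fixes X :: "'a \<Rightarrow> real ^ 'n"
  assumes X[measurable]: "X \<in> borel_measurable M" and ne: "dual_cone C - {0} \<noteq> {}" and s: "s > 0"
  shows "VaR M C \<alpha> (\<lambda>\<omega>. s *\<^sub>R X \<omega>) = (\<lambda>b. s *\<^sub>R b) ` VaR M C \<alpha> X"
proof -
  have sX: "(\<lambda>\<omega>. s *\<^sub>R X \<omega>) \<in> borel_measurable M" by simp
  have "w \<bullet> (s *\<^sub>R x) + w \<bullet> (s *\<^sub>R b) < 0 \<longleftrightarrow> w \<bullet> x + w \<bullet> b < 0" for w x b :: "real ^ 'n"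
    using s by (simp add: distrib_left[symmetric] mult_less_0_iff)
  hence *: "s *\<^sub>R b \<in> VaR M C \<alpha> (\<lambda>\<omega>. s *\<^sub>R X \<omega>) \<longleftrightarrow> b \<in> VaR M C \<alpha> X" for b
    unfolding mem_VaR_iff[OF sX ne] mem_VaR_iff[OF X ne] by (simp only:)
  show ?thesis
  proof (intro equalityI subsetI)
    fix z assume "z \<in> VaR M C \<alpha> (\<lambda>\<omega>. s *\<^sub>R X \<omega>)"
    moreover have "z = s *\<^sub>R (inverse s *\<^sub>R z)" using s by simp
    ultimately show "z \<in> (\<lambda>b. s *\<^sub>R b) ` VaR M C \<alpha> X" using * by (metis image_eqI)
  qed (use * in blast)
qed

lemma VaR_translate:
  fixes X :: "'a \<Rightarrow> real ^ 'n"
  assumes X[measurable]: "X \<in> borel_measurable M" and ne: "dual_cone C - {0} \<noteq> {}"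
  shows "VaR M C \<alpha> (\<lambda>\<omega>. X \<omega> + y) = (\<lambda>b. b - y) ` VaR M C \<alpha> X"
proof -
  have yX: "(\<lambda>\<omega>. X \<omega> + y) \<in> borel_measurable M" by simp
  have "w \<bullet> (x + y) + w \<bullet> (b - y) < 0 \<longleftrightarrow> w \<bullet> x + w \<bullet> b < 0" for w x b :: "real ^ 'n"
    by (simp add: inner_simps)
  hence *: "b - y \<in> VaR M C \<alpha> (\<lambda>\<omega>. X \<omega> + y) \<longleftrightarrow> b \<in> VaR M C \<alpha> X" for b
    unfolding mem_VaR_iff[OF yX ne] mem_VaR_iff[OF X ne] by (simp only:)
  show ?thesis
  proof (intro equalityI subsetI)
    fix z assume "z \<in> VaR M C \<alpha> (\<lambda>\<omega>. X \<omega> + y)"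
    moreover have "z = (z + y) - y" by simp
    ultimately show "z \<in> (\<lambda>b. b - y) ` VaR M C \<alpha> X" using * by (metis image_eqI)
  qed (use * in blast)
qed

text \<open>Pairing with \<open>w\<close> in the dual cone turns the cone order into
  \<open>w \<bullet> X \<le> w \<bullet> Y\<close> almost surely, so up to a null set the event for
  \<open>Y\<close> is contained in the one for \<open>X\<close>.\<close>

lemma VaR_mono:
  fixes X Y :: "'a \<Rightarrow> real ^ 'n"
  assumes X[measurable]: "X \<in> borel_measurable M" and Y[measurable]: "Y \<in> borel_measurable M"
    and ne: "dual_cone C - {0} \<noteq> {}" and le: "AE \<omega> in M. cone_le C (X \<omega>) (Y \<omega>)"
  shows "VaR M C \<alpha> X \<subseteq> VaR M C \<alpha> Y"
proof
  fix z assume z: "z \<in> VaR M C \<alpha> X"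
  have "prob {\<omega> \<in> space M. w \<bullet> Y \<omega> + w \<bullet> z < 0} \<le> \<alpha>" if w: "w \<in> dual_cone C - {0}" for w
  proof -
    have "prob {\<omega> \<in> space M. w \<bullet> Y \<omega> + w \<bullet> z < 0} \<le> prob {\<omega> \<in> space M. w \<bullet> X \<omega> + w \<bullet> z < 0}"
    proof (rule finite_measure_mono_AE)
      show "AE \<omega> in M. \<omega> \<in> {\<omega> \<in> space M. w \<bullet> Y \<omega> + w \<bullet> z < 0} \<longrightarrow>
          \<omega> \<in> {\<omega> \<in> space M. w \<bullet> X \<omega> + w \<bullet> z < 0}"
        using le
      proof eventually_elim
        case (elim \<omega>)
        hence "w \<bullet> X \<omega> \<le> w \<bullet> Y \<omega>"
          using w unfolding cone_le_def dual_cone_def by (auto simp: inner_diff_right)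
        thus ?case by auto
      qed
    qed simp
    also have "\<dots> \<le> \<alpha>" using z w mem_VaR_iff[OF X ne] by blast
    finally show ?thesis .
  qed
  thus "z \<in> VaR M C \<alpha> Y" using mem_VaR_iff[OF Y ne] by blast
qed

lemma VaR_eq_INT:
  fixes X :: "'a \<Rightarrow> real ^ 'n"
  assumes X: "X \<in> borel_measurable M" and ne: "dual_cone C - {0} \<noteq> {}"
  shows "VaR M C \<alpha> X = (\<Inter>w\<in>dual_cone C - {0}.
    {z. prob {\<omega> \<in> space M. X \<omega> + z \<in> uminus ` interior (pos_halfspace w)} \<le> \<alpha>})"
  using mem_VaR_iff[OF X ne] by (auto simp: add_mem_uminus_interior_pos_halfspace)

text \<open>Probabilities are bounded by 1 and the family is nonempty, so the real supremum is
  genuine and is at most \<open>\<alpha>\<close> iff all members are.\<close>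

lemma VaR_eq_SUP:
  fixes X :: "'a \<Rightarrow> real ^ 'n"
  assumes X: "X \<in> borel_measurable M" and ne: "dual_cone C - {0} \<noteq> {}"
  shows "VaR M C \<alpha> X = {z. (SUP w\<in>dual_cone C - {0}.
    prob {\<omega> \<in> space M. X \<omega> + z \<in> uminus ` interior (pos_halfspace w)}) \<le> \<alpha>}"
proof -
  have "bdd_above ((\<lambda>w. prob {\<omega> \<in> space M. X \<omega> + z \<in> uminus ` interior (pos_halfspace w)}) `
      (dual_cone C - {0}))" for z
    by (rule bdd_aboveI2[of _ _ 1]) simp
  from cSUP_le_iff[OF ne this] show ?thesis unfolding VaR_eq_INT[OF X ne] by auto
qed

end

theorem proposition6p2:
  fixes M :: "'a measure" and C :: "(real ^ 'n) set" and \<alpha> :: real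
  assumes "prob_space M"
    and "closed C" and "convex C" and "pos_cone C" and "0 \<in> C" and "C \<subset> UNIV"
    and "0 < \<alpha>" and "\<alpha> \<le> 1"
  shows "(\<forall>X \<in> borel_measurable M.
            VaR M C \<alpha> X =
              {z. (SUP w\<in>dual_cone C - {0}.
                     measure M {\<omega> \<in> space M. X \<omega> + z \<in> uminus ` interior (pos_halfspace w)}) \<le> \<alpha>} \<and>
            VaR M C \<alpha> X =
              (\<Inter>w\<in>dual_cone C - {0}.
                 {z. measure M {\<omega> \<in> space M. X \<omega> + z \<in> uminus ` interior (pos_halfspace w)} \<le> \<alpha>})) \<and>
         (\<forall>X \<in> borel_measurable M. VaR M C \<alpha> X \<in> closed_convex_upper_sets C) \<and>
         (\<forall>X \<in> borel_measurable M. \<forall>s>0.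
            VaR M C \<alpha> (\<lambda>\<omega>. s *\<^sub>R X \<omega>) = (\<lambda>b. s *\<^sub>R b) ` VaR M C \<alpha> X) \<and>
         (\<forall>X \<in> borel_measurable M. \<forall>y.
            VaR M C \<alpha> (\<lambda>\<omega>. X \<omega> + y) = (\<lambda>b. b - y) ` VaR M C \<alpha> X) \<and>
         (\<forall>X \<in> borel_measurable M. \<forall>Y \<in> borel_measurable M.
            (AE \<omega> in M. cone_le C (X \<omega>) (Y \<omega>)) \<longrightarrow> VaR M C \<alpha> X \<subseteq> VaR M C \<alpha> Y)"
proof -
  interpret prob_space M by fact
  \<comment> \<open>Here closedness, convexity and properness of \<open>C\<close> enter: they supply
    the nonempty family of directions that each lemma takes as a premise.\<close>
  have ne: "dual_cone C - {0} \<noteq> {}"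
    using assms(2-6) by (intro dual_cone_nontrivial) auto
  show ?thesis
    using VaR_eq_SUP[OF _ ne] VaR_eq_INT[OF _ ne] VaR_closed_convex_upper[OF _ ne \<open>0 \<in> C\<close>]
      VaR_scaleR[OF _ ne] VaR_translate[OF _ ne] VaR_mono[OF _ _ ne]
    by (intro conjI ballI allI impI)
qed

end
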